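(* Let $M,N\ge1$ be integers, $D>0$, $p>1$ real numbers, and let $q$ be defined by $\frac1p+\frac1q=1$. Let $y_1,\dots,y_M\in\{+1,-1\}$ and $H\in\{+1,-1\}^{M\times N}$ with rows $H_1,\dots,H_M$ and entries $H_{ij}$. The Lagrange dual of the soft-margin LPBoost problem with generalized hinge loss $$\max_{w\in\mathbb{R}^N,\ \varrho\in\mathbb{R},\ \xi\in\mathbb{R}^M}\ \varrho-D\sum_{i=1}^M\xi_i^p\quad\text{s.t.}\quad y_iH_iw\ge\varrho-\xi_i\ (i=1,\dots,M),\quad w\ge0,\quad\mathbf{1}^\top w=1,\quad\xi\ge0,$$ is the problem $$\min_{r\in\mathbb{R},\ u\in\mathbb{R}^M}\ r+D^{1-q}\bigl(p^{1-q}-p^{-q}\bigr)\sum_{i=1}^M u_i^q\quad\text{s.t.}\quad\sum_{i=1}^M u_iy_iH_{ij}\le r\ (j=1,\dots,N),\quad u\ge0,\quad\mathbf{1}^\top u=1 .$$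
   Context: Setting: training examples $x_1,\dots,x_M$ with labels $y_i\in\{+1,-1\}$, weak classifiers $h_1,\dots,h_N$ with values in $\{+1,-1\}$, and $H_{ij}=h_j(x_i)$; the row vector $H_i=[H_{i1}\ \cdots\ H_{iN}]$ is the $i$-th row of $H$. The generalized hinge loss is $(\max\{0,1-yF(x)\})^p$. Vector inequalities are componentwise and $\mathbf{1}$ is the all-ones vector. The Lagrange dual is formed with the Lagrangian $$L(w,\varrho,\xi,u,s,r)=\varrho-D\sum_{i=1}^M\xi_i^p+\sum_{i=1}^M u_i(y_iH_iw-\varrho+\xi_i)+s^\top w-r(\mathbf{1}^\top w-1),$$ with multipliers $u\in\mathbb{R}^M$, $u\ge0$; $s\in\mathbb{R}^N$, $s\ge0$; $r\in\mathbb{R}$. The constraint $\xi\ge0$ is kept as the domain of $\xi$ and is not dualized. The dual function is $g(u,s,r)=\sup_{w\in\mathbb{R}^N,\ \varrho\in\mathbb{R},\ \xi\ge0}L(w,\varrho,\xi,u,s,r)\in(-\infty,\infty]$, and the dual problem is to minimize $g(u,s,r)$ over $u\ge0$, $s\ge0$, $r\in\mathbb{R}$. "The dual is" the stated problem means: after making the condition $g<\infty$ explicit as constraints and eliminating $s$, the dual problem becomes the stated one. That is, for every $u\ge 0$ and $r$, $\inf_{s\ge0}g(u,s,r)$ equals the stated objective if $(u,r)$ satisfies the stated constraints, and equals $+\infty$ otherwise. *)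

theory Defs
  imports "HOL-Analysis.Analysis"
begin

text \<open>
  The index type \<open>'m\<close> enumerates the \<open>M\<close> training examples and \<open>'n\<close> the \<open>N\<close> weak classifiers,
  so \<open>H :: real^'n^'m\<close> is an \<open>M\<close> by \<open>N\<close> matrix and \<open>(H *v w) $ i\<close> is \<open>H\<^sub>i w\<close>.  The order on
  vectors is the componentwise one.  Powers with real exponent are \<open>powr\<close>; every base to which
  a variable power is applied is nonnegative, and \<open>0 powr p = 0\<close>.
\<close>

definition primal_objective :: "real \<Rightarrow> real \<Rightarrow> real \<Rightarrow> real^'m \<Rightarrow> real" where
  "primal_objective D p \<rho> \<xi> = \<rho> - D * (\<Sum>i\<in>UNIV. \<xi> $ i powr p)"

definition primal_feasible ::
  "real^'m \<Rightarrow> real^'n^'m \<Rightarrow> ((real^'n) \<times> real \<times> (real^'m)) set" where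
  "primal_feasible y H = {(w, \<rho>, \<xi>).
     (\<forall>i. y $ i * (H *v w) $ i \<ge> \<rho> - \<xi> $ i) \<and> 0 \<le> w \<and> (\<Sum>j\<in>UNIV. w $ j) = 1 \<and> 0 \<le> \<xi>}"

definition lagrangian ::
  "real \<Rightarrow> real \<Rightarrow> real^'m \<Rightarrow> real^'n^'m \<Rightarrow> real^'n \<Rightarrow> real \<Rightarrow> real^'m
     \<Rightarrow> real^'m \<Rightarrow> real^'n \<Rightarrow> real \<Rightarrow> real" where
  "lagrangian D p y H w \<rho> \<xi> u s r =
     primal_objective D p \<rho> \<xi>
     + (\<Sum>i\<in>UNIV. u $ i * (y $ i * (H *v w) $ i - \<rho> + \<xi> $ i))
     + s \<bullet> w - r * ((\<Sum>j\<in>UNIV. w $ j) - 1)"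

text \<open>
  The constraint \<open>\<xi> \<ge> 0\<close> is not dualized: it is the domain of \<open>\<xi>\<close>.  The supremum is taken in the
  extended reals, so it may be \<open>\<infinity>\<close>.
\<close>

definition dual_function ::
  "real \<Rightarrow> real \<Rightarrow> real^'m \<Rightarrow> real^'n^'m \<Rightarrow> real^'m \<Rightarrow> real^'n \<Rightarrow> real \<Rightarrow> ereal" where
  "dual_function D p y H u s r =
     (SUP (w, \<rho>, \<xi>) \<in> UNIV \<times> UNIV \<times> {\<xi>. 0 \<le> \<xi>}. ereal (lagrangian D p y H w \<rho> \<xi> u s r))"

definition dual_objective :: "real \<Rightarrow> real \<Rightarrow> real \<Rightarrow> real^'m \<Rightarrow> real \<Rightarrow> real" where
  "dual_objective D p q u r =
     r + D powr (1 - q) * (p powr (1 - q) - p powr (- q)) * (\<Sum>i\<in>UNIV. u $ i powr q)"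

definition dual_feasible :: "real^'m \<Rightarrow> real^'n^'m \<Rightarrow> ((real^'m) \<times> real) set" where
  "dual_feasible y H = {(u, r).
     (\<forall>j. (\<Sum>i\<in>UNIV. u $ i * y $ i * H $ i $ j) \<le> r) \<and> 0 \<le> u \<and> (\<Sum>i\<in>UNIV. u $ i) = 1}"

text \<open>
  The Lagrangian encodes the primal problem: on the domain \<open>\<xi> \<ge> 0\<close>, it majorizes the objective for
  all admissible multipliers exactly at the feasible points.
\<close>

lemma primal_feasible_iff_lagrangian:
  fixes y :: "real^'m" and H :: "real^'n^'m"
  assumes "0 \<le> \<xi>"
  shows "(w, \<rho>, \<xi>) \<in> primal_feasible y H \<longleftrightarrow>
    (\<forall>u s r. 0 \<le> u \<longrightarrow> 0 \<le> s \<longrightarrow> primal_objective D p \<rho> \<xi> \<le> lagrangian D p y H w \<rho> \<xi> u s r)"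
    (is "?F \<longleftrightarrow> ?L")
proof
  assume F: ?F
  show ?L
  proof (intro allI impI)
    fix u :: "real^'m" and s :: "real^'n" and r :: real
    assume "0 \<le> u" "0 \<le> s"
    have "0 \<le> (\<Sum>i\<in>UNIV. u $ i * (y $ i * (H *v w) $ i - \<rho> + \<xi> $ i))"
      using F \<open>0 \<le> u\<close>
      by (intro sum_nonneg mult_nonneg_nonneg) (auto simp: primal_feasible_def less_eq_vec_def algebra_simps)
    moreover have "0 \<le> s \<bullet> w"
      using F \<open>0 \<le> s\<close> unfolding inner_vec_def
      by (intro sum_nonneg) (auto simp: primal_feasible_def less_eq_vec_def)
    ultimately show "primal_objective D p \<rho> \<xi> \<le> lagrangian D p y H w \<rho> \<xi> u s r"
      using F by (simp add: lagrangian_def primal_feasible_def)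
  qed
next
  assume L: ?L
  have margin: "\<rho> - \<xi> $ i \<le> y $ i * (H *v w) $ i" for i
  proof -
    have "0 \<le> (axis i 1 :: real^'m)" by (simp add: less_eq_vec_def axis_def)
    then have "primal_objective D p \<rho> \<xi> \<le> lagrangian D p y H w \<rho> \<xi> (axis i 1) 0 0"
      using L by simp
    then show ?thesis
      by (simp add: lagrangian_def axis_def if_distrib [of "\<lambda>t. t * _"] cong: if_cong)
  qed
  have "0 \<le> w $ j" for j
  proof -
    have "0 \<le> (axis j 1 :: real^'n)" by (simp add: less_eq_vec_def axis_def)
    then have "primal_objective D p \<rho> \<xi> \<le> lagrangian D p y H w \<rho> \<xi> 0 (axis j 1) 0"
      using L by simp
    then show ?thesis by (simp add: lagrangian_def inner_axis')
  qed
  moreover have "(\<Sum>j\<in>UNIV. w $ j) = 1"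
  proof -
    have "primal_objective D p \<rho> \<xi> \<le> lagrangian D p y H w \<rho> \<xi> 0 0 1"
      "primal_objective D p \<rho> \<xi> \<le> lagrangian D p y H w \<rho> \<xi> 0 0 (- 1)"
      using L by blast+
    then show ?thesis by (simp add: lagrangian_def)
  qed
  ultimately show ?F
    using margin assms by (simp add: primal_feasible_def less_eq_vec_def)
qed

end

theory Submission
  imports Defs
begin

text \<open>
  Regrouped by primal variable, the Lagrangian is
  \<open>r + \<rho> (1 - \<Sum>\<^sub>i u\<^sub>i) + \<Sum>\<^sub>j (c\<^sub>j + s\<^sub>j - r) w\<^sub>j + \<Sum>\<^sub>i (u\<^sub>i \<xi>\<^sub>i - D \<xi>\<^sub>i\<^sup>p)\<close>
  with \<open>c\<^sub>j = \<Sum>\<^sub>i u\<^sub>i y\<^sub>i H\<^sub>i\<^sub>j\<close>.  The free variables \<open>\<rho>\<close> and \<open>w\<close> force their coefficients to vanish, and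
  the supremum over each \<open>\<xi>\<^sub>i \<ge> 0\<close> is the convex conjugate of \<open>D x\<^sup>p\<close>, given by Young's inequality
  with equality at \<open>x = (u\<^sub>i / (p D))\<^bsup>q - 1\<^esup>\<close>.  Hence \<open>s = r \<one> - c\<close> is the only slack
  with a finite dual value, and its nonnegativity is the margin constraint.
\<close>

lemma conjugate_powr_le:
  fixes D p q u x :: real
  assumes D: "D > 0" and p: "p > 1" and pq: "1 / p + 1 / q = 1" and u: "u \<ge> 0" and x: "x \<ge> 0"
  shows "u * x - D * x powr p \<le> D powr (1 - q) * (p powr (1 - q) - p powr (- q)) * u powr q"
proof -
  have "q \<noteq> 0" using p pq by auto
  have pq': "p + q = p * q" using p pq \<open>q \<noteq> 0\<close> by (simp add: field_simps)
  have "(p - 1) * (q - 1) = 1" using pq' by (simp add: algebra_simps)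
  then have q: "q > 1" using p by (metis diff_gt_0_iff_gt zero_less_mult_pos zero_less_one)
  \<comment> \<open>The scale satisfies \<open>b powr p = p * D\<close>, so Young's inequality for
    the factors \<open>b * x\<close> and \<open>u / b\<close> keeps the product \<open>u * x\<close>
    and turns its first term into exactly \<open>D * x powr p\<close>.\<close>
  define b where "b = (p * D) powr (1 / p)"
  have b: "b > 0" using D p by (simp add: b_def)
  have "(b * x) * (u / b) \<le> (b * x) powr p / p + (u / b) powr q / q"
    using b p q u x pq by (intro Youngs_inequality) auto
  moreover have "(b * x) powr p / p = D * x powr p"
    using b D p x by (simp add: powr_mult b_def powr_powr)
  moreover have "(u / b) powr q / q = D powr (1 - q) * (p powr (1 - q) - p powr (- q)) * u powr q"
  proof -
    have e: "- (q / p) = 1 - q" using p pq' by (simp add: field_simps)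
    have bq: "b powr - q = (p * D) powr (1 - q)"
      using p by (simp add: b_def powr_powr e)
    have "(u / b) powr q / q = u powr q * (p * D) powr (1 - q) * (1 / q)"
      using b u by (simp add: powr_divide powr_minus_divide flip: bq)
    also have "\<dots> = D powr (1 - q) * (p powr (1 - q) * (1 / q)) * u powr q"
      using p D by (simp add: powr_mult)
    \<comment> \<open>Writing \<open>1 / q\<close> as \<open>1 - 1 / p\<close> produces the
      difference of powers of \<open>p\<close> in the dual objective.\<close>
    also have "1 / q = 1 - 1 / p" using pq by simp
    also have "p powr (1 - q) * (1 - 1 / p) = p powr (1 - q) - p powr (- q)"
      using p by (simp add: powr_diff powr_minus field_simps)
    finally show ?thesis .
  qed
  ultimately show ?thesis using b by (simp add: mult.commute)
qed

text \<open>The point \<open>x\<close> solves the stationarity equation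
  \<open>u = p * D * x powr (p - 1)\<close>, because \<open>1 / (p - 1) = q - 1\<close>.\<close>

lemma conjugate_powr_attained:
  fixes D p q u :: real
  assumes D: "D > 0" and p: "p > 1" and pq: "1 / p + 1 / q = 1" and u: "u \<ge> 0"
  defines "x \<equiv> (u / (p * D)) powr (q - 1)"
  shows "u * x - D * x powr p = D powr (1 - q) * (p powr (1 - q) - p powr (- q)) * u powr q"
\<comment> \<open>At \<open>u = 0\<close> both sides vanish since \<open>0 powr a = 0\<close>; the
  other case cancels a factor \<open>u\<close>.\<close>
proof (cases "u = 0")
  case True
  then show ?thesis by (simp add: x_def)
next
  case False
  with u have u: "u > 0" by simp
  have "q \<noteq> 0" using p pq by auto
  then have pq': "p + q = p * q" using p pq by (simp add: field_simps)
  have e: "(q - 1) * p = q" using pq' by (simp add: algebra_simps)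
  have xp: "x powr p = (u / (p * D)) powr q" by (simp add: x_def powr_powr e)
  show ?thesis
    unfolding xp unfolding x_def
    using u p D by (simp add: powr_divide powr_mult powr_diff powr_minus field_simps)
qed

lemma lagrangian_regroup:
  fixes y :: "real^'m" and H :: "real^'n^'m"
  shows "lagrangian D p y H w \<rho> \<xi> u s r =
    r + \<rho> * (1 - (\<Sum>i\<in>UNIV. u $ i))
      + (\<Sum>j\<in>UNIV. ((\<Sum>i\<in>UNIV. u $ i * y $ i * H $ i $ j) + s $ j - r) * w $ j)
      + (\<Sum>i\<in>UNIV. u $ i * \<xi> $ i - D * \<xi> $ i powr p)"
proof -
  have "(\<Sum>i\<in>UNIV. u $ i * (y $ i * (H *v w) $ i)) =
      (\<Sum>i\<in>UNIV. \<Sum>j\<in>UNIV. u $ i * y $ i * H $ i $ j * w $ j)"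
    by (simp add: matrix_vector_mult_def sum_distrib_left mult.assoc)
  also have "\<dots> = (\<Sum>j\<in>UNIV. (\<Sum>i\<in>UNIV. u $ i * y $ i * H $ i $ j) * w $ j)"
    by (subst sum.swap) (simp add: sum_distrib_right)
  finally have "(\<Sum>i\<in>UNIV. u $ i * (y $ i * (H *v w) $ i)) = \<dots>" .
  then show ?thesis
    by (simp add: lagrangian_def primal_objective_def inner_vec_def sum.distrib sum_subtractf
        sum_distrib_left sum_distrib_right algebra_simps)
qed

text \<open>The offset \<open>a\<close> fits lines in the primal space along which the Lagrangian is
  a constant plus an arbitrary \<open>t\<close>.\<close>

lemma dual_function_eq_PInfty:
  assumes "\<And>t::real. \<exists>w \<rho> \<xi>. 0 \<le> \<xi> \<and> lagrangian D p y H w \<rho> \<xi> u s r = a + t"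
  shows "dual_function D p y H u s r = \<infinity>"
  unfolding dual_function_def
proof (rule SUP_PInfty)
  fix n :: nat
  obtain w \<rho> \<xi> where "0 \<le> \<xi>" "lagrangian D p y H w \<rho> \<xi> u s r = a + (real n - a)"
    using assms by blast
  then show "\<exists>z\<in>UNIV \<times> UNIV \<times> {\<xi>. 0 \<le> \<xi>}.
      ereal (real n) \<le> (case z of (w, \<rho>, \<xi>) \<Rightarrow> ereal (lagrangian D p y H w \<rho> \<xi> u s r))"
    by (intro bexI [of _ "(w, \<rho>, \<xi>)"]) auto
qed

text \<open>With \<open>s\<close> still present the condition for each \<open>j\<close> is an
  equation, as \<open>w\<close> ranges over the whole space; it becomes an inequality only when
  \<open>s\<close> is eliminated.\<close>

lemma dual_function_eq:
  fixes y :: "real^'m" and H :: "real^'n^'m"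
  assumes D: "D > 0" and p: "p > 1" and pq: "1 / p + 1 / q = 1" and u: "0 \<le> u"
  shows "dual_function D p y H u s r =
    (if (\<Sum>i\<in>UNIV. u $ i) = 1 \<and> (\<forall>j. (\<Sum>i\<in>UNIV. u $ i * y $ i * H $ i $ j) + s $ j = r)
     then ereal (dual_objective D p q u r) else \<infinity>)"
proof -
  define d where "d j = (\<Sum>i\<in>UNIV. u $ i * y $ i * H $ i $ j) + s $ j - r" for j
  let ?L = "\<lambda>w \<rho> \<xi>. lagrangian D p y H w \<rho> \<xi> u s r"
  have L: "?L w \<rho> \<xi> = r + \<rho> * (1 - (\<Sum>i\<in>UNIV. u $ i)) + (\<Sum>j\<in>UNIV. d j * w $ j)
      + (\<Sum>i\<in>UNIV. u $ i * \<xi> $ i - D * \<xi> $ i powr p)" for w \<rho> \<xi>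
    by (simp add: lagrangian_regroup d_def)
  consider (rho) "(\<Sum>i\<in>UNIV. u $ i) \<noteq> 1" | (w) j where "d j \<noteq> 0"
    | (finite) "(\<Sum>i\<in>UNIV. u $ i) = 1" "\<And>j. d j = 0" by blast
  then show ?thesis
  proof cases
    case rho
    \<comment> \<open>Only \<open>\<rho>\<close> moves; dividing by its nonzero coefficient makes
      the value run through all reals.\<close>
    have "?L 0 (t / (1 - (\<Sum>i\<in>UNIV. u $ i))) 0 = r + t" for t
      using rho by (simp add: L)
    then have "dual_function D p y H u s r = \<infinity>"
      by (intro dual_function_eq_PInfty [where a = r]) (metis order_refl)
    with rho show ?thesis by simp
  next
    case w
    have "?L (axis j (t / d j)) 0 0 = r + t" for t
      using w by (simp add: L axis_def if_distrib [of "\<lambda>t. _ * t"] cong: if_cong)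
    then have "dual_function D p y H u s r = \<infinity>"
      by (intro dual_function_eq_PInfty [where a = r]) (metis order_refl)
    with w show ?thesis by (auto simp: d_def)
  next
    case finite
    have L: "?L w \<rho> \<xi> = r + (\<Sum>i\<in>UNIV. u $ i * \<xi> $ i - D * \<xi> $ i powr p)" for w \<rho> \<xi>
      using finite by (simp add: L)
    define \<xi>' :: "real^'m" where "\<xi>' = (\<chi> i. (u $ i / (p * D)) powr (q - 1))"
    have le: "?L w \<rho> \<xi> \<le> dual_objective D p q u r" if "0 \<le> \<xi>" for w \<rho> \<xi>
      unfolding L dual_objective_def sum_distrib_left using u that
      by (intro add_left_mono sum_mono conjugate_powr_le [OF D p pq]) (auto simp: less_eq_vec_def)
    \<comment> \<open>The zeros are arbitrary choices, since the coefficients of \<open>w\<close>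
      and \<open>\<rho>\<close> vanish here; \<open>\<xi>'\<close> maximizes coordinate by
      coordinate.\<close>
    have eq: "?L 0 0 \<xi>' = dual_objective D p q u r"
      unfolding L dual_objective_def sum_distrib_left \<xi>'_def vec_lambda_beta using u
      by (intro arg_cong2 [where f = "(+)"] refl sum.cong conjugate_powr_attained [OF D p pq])
        (auto simp: less_eq_vec_def)
    have "0 \<le> \<xi>'" by (simp add: \<xi>'_def less_eq_vec_def)
    then have "dual_function D p y H u s r = ereal (dual_objective D p q u r)"
      unfolding dual_function_def using le
      by (intro antisym SUP_least SUP_upper2 [of "(0, 0, \<xi>')"]) (auto simp: eq)
    with finite show ?thesis by (simp add: d_def)
  qed
qed

theorem mainTheorem3:
  fixes D p q :: real
    and y :: "real^'m"
    and H :: "real^'n^'m"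
  assumes "D > 0"
    and "p > 1"
    and "1 / p + 1 / q = 1"
    and "\<forall>i. y $ i \<in> {1, -1}"
    and "\<forall>i j. H $ i $ j \<in> {1, -1}"
  shows "\<forall>u r. 0 \<le> u \<longrightarrow>
    (INF s \<in> {s. 0 \<le> s}. dual_function D p y H u s r) =
      (if (u, r) \<in> dual_feasible y H then ereal (dual_objective D p q u r) else \<infinity>)"
proof (intro allI impI)
  fix u :: "real^'m" and r :: real
  assume u: "0 \<le> u"
  define c where "c j = (\<Sum>i\<in>UNIV. u $ i * y $ i * H $ i $ j)" for j
  note g = dual_function_eq [OF assms(1-3) u, of y H _ r, folded c_def]
  show "(INF s \<in> {s. 0 \<le> s}. dual_function D p y H u s r) =
      (if (u, r) \<in> dual_feasible y H then ereal (dual_objective D p q u r) else \<infinity>)"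
  proof (cases "(u, r) \<in> dual_feasible y H")
    case True
    then have sum: "(\<Sum>i\<in>UNIV. u $ i) = 1" and c: "c j \<le> r" for j
      by (auto simp: dual_feasible_def c_def)
    \<comment> \<open>Each slack yields the dual objective or \<open>\<infinity>\<close>, so one
      nonnegative slack that meets all the equations settles the infimum.\<close>
    have "0 \<le> (\<chi> j. r - c j)" using c by (simp add: less_eq_vec_def)
    then have "(INF s \<in> {s. 0 \<le> s}. dual_function D p y H u s r) = ereal (dual_objective D p q u r)"
      by (intro antisym INF_greatest INF_lower2 [of "\<chi> j. r - c j"]) (auto simp: g sum)
    with True show ?thesis by simp
  next
    case False
    have "dual_function D p y H u s r = \<infinity>" if "0 \<le> s" for s
    proof -
      \<comment> \<open>A finite value at some \<open>s \<ge> 0\<close> would make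
        \<open>(u, r)\<close> feasible.\<close>
      have "c j \<le> r" if "c j + s $ j = r" for j
        using that \<open>0 \<le> s\<close> by (auto simp: less_eq_vec_def dest: spec [of _ j])
      with False u show ?thesis by (auto simp: g dual_feasible_def c_def [symmetric])
    qed
    then have "(INF s \<in> {s. 0 \<le> s}. dual_function D p y H u s r) = (INF s \<in> {s::real^'n. 0 \<le> s}. \<infinity>)"
      by (intro INF_cong) auto
    also have "\<dots> = \<infinity>" by (intro INF_const) auto
    finally show ?thesis using False by simp
  qed
qed

end
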